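(* Let $1/2<p\le1$, and in the $\mathrm{AOS}p$ model let $H'\subseteq H$ be such that each $u\in H$ is drawn to $H'$ independently with probability $(1-p)/p$. Then the $\mathrm{AOS}p$ greedy-based algorithm for weighted bipartite matching with one-sided vertex arrivals, run with sample $L'=H'$ (instead of $L'=H$), is $1/4$-competitive.
   Context: $\mathrm{AOS}p$ model for bipartite matching with vertex arrivals: (1) The adversary generates a finite bipartite graph $G=(L,R,E)$ with weights $w:E\to\mathbb{R}_{\ge0}$ (ties broken by a fixed consistent rule, so edge weights are totally ordered). (2) Each $u\in L$ is put in the history set $H$ independently with probability $p$; the value $p$ and the subgraph induced on $H\cup R$ are given to the online player upfront. The online set is $O=L\setminus H$. (3) The vertices of $O$ arrive one by one in an adversarial order (which may depend on $H$). When a vertex arrives, its incident edges and their weights are revealed, and the player must immediately and irrevocably match it to an unmatched neighbor or leave it unmatched. For $U\subseteq L$, $G[U]$ denotes the subgraph induced on $U\cup R$. $\mathrm{OPT}$ is the (random) maximum weight of a matching in $G[O]$. An algorithm is $c$-competitive if $\mathrm{E}[\mathrm{ALG}]\ge c\cdot\mathrm{E}[\mathrm{OPT}]$ on every instance $(G,p)$, where $\mathrm{ALG}$ is the weight of its output matching and expectations are over $H$ and the algorithm's internal randomness (here, the choice of $H'$). $\mathrm{Greedy}(K)$: process the edges of $K$ in non-increasing order of weight, adding an edge to the matching iff neither endpoint is already covered. Greedy-based algorithm with sample $L'$: set $M=\emptyset$. When $u\in O$ arrives, compute $\mathrm{Greedy}(G[L'\cup\{u\}])$; if $u$ is matched in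 it by an edge $(u,r)$ and $r$ is not yet matched in $M$, add $(u,r)$ to $M$. Output $M$. *)

theory Defs
  imports "HOL-Probability.Probability"
begin

text \<open>
  Edge-weighted bipartite graphs. The two sides have different types, so they are disjoint.
  The field \<open>ranking\<close> lists the edges by non-increasing weight; where weights are equal, the
  order in the list is the tie-breaking rule, which is an arbitrary part of the instance.
\<close>

record ('l, 'r) wbigraph =
  left :: "'l set"
  right :: "'r set"
  edges :: "('l \<times> 'r) set"
  weight :: "'l \<times> 'r \<Rightarrow> real"
  ranking :: "('l \<times> 'r) list"

definition wf_wbigraph :: "('l, 'r) wbigraph \<Rightarrow> bool" where
  "wf_wbigraph G \<longleftrightarrow>
     finite (left G) \<and> finite (right G) \<and>
     edges G \<subseteq> left G \<times> right G \<and>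
     (\<forall>e\<in>edges G. 0 \<le> weight G e) \<and>
     set (ranking G) = edges G \<and> distinct (ranking G) \<and>
     sorted_wrt (\<lambda>e f. weight G e \<ge> weight G f) (ranking G)"

text \<open>The subgraph induced on \<open>U \<union> right G\<close>; it inherits the tie-breaking rule.\<close>

definition induced :: "('l, 'r) wbigraph \<Rightarrow> 'l set \<Rightarrow> ('l, 'r) wbigraph" where
  "induced G U = G\<lparr>left := left G \<inter> U,
                   edges := {e \<in> edges G. fst e \<in> U},
                   ranking := filter (\<lambda>e. fst e \<in> U) (ranking G)\<rparr>"

lemma wf_induced: "wf_wbigraph G \<Longrightarrow> wf_wbigraph (induced G U)"
  by (auto simp: wf_wbigraph_def induced_def sorted_wrt_filter)

definition matching :: "('l, 'r) wbigraph \<Rightarrow> ('l \<times> 'r) set \<Rightarrow> bool" where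
  "matching G M \<longleftrightarrow> M \<subseteq> edges G \<and> inj_on fst M \<and> inj_on snd M"

definition matching_weight :: "('l, 'r) wbigraph \<Rightarrow> ('l \<times> 'r) set \<Rightarrow> real" where
  "matching_weight G M = (\<Sum>e\<in>M. weight G e)"

definition max_matching_weight :: "('l, 'r) wbigraph \<Rightarrow> real" where
  "max_matching_weight G = Max {matching_weight G M |M. matching G M}"

definition greedy_step :: "('l \<times> 'r) set \<Rightarrow> 'l \<times> 'r \<Rightarrow> ('l \<times> 'r) set" where
  "greedy_step M e = (if fst e \<notin> fst ` M \<and> snd e \<notin> snd ` M then insert e M else M)"

definition greedy :: "('l, 'r) wbigraph \<Rightarrow> ('l \<times> 'r) set" where
  "greedy G = foldl greedy_step {} (ranking G)"

text \<open>Since a greedy matching covers \<open>u\<close> at most once, each step adds at most one edge.\<close>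

definition online_step ::
  "('l, 'r) wbigraph \<Rightarrow> 'l set \<Rightarrow> ('l \<times> 'r) set \<Rightarrow> 'l \<Rightarrow> ('l \<times> 'r) set" where
  "online_step G S M u =
     M \<union> {(u, r) |r. (u, r) \<in> greedy (induced G (S \<union> {u})) \<and> r \<notin> snd ` M}"

definition greedy_based ::
  "('l, 'r) wbigraph \<Rightarrow> 'l set \<Rightarrow> 'l list \<Rightarrow> ('l \<times> 'r) set" where
  "greedy_based G S us = foldl (online_step G S) {} us"

definition random_subset :: "'a set \<Rightarrow> real \<Rightarrow> 'a set pmf" where
  "random_subset A q =
     map_pmf (\<lambda>f. {x \<in> A. f x}) (Pi_pmf A False (\<lambda>_. bernoulli_pmf q))"

text \<open>The adversary's choice, for every history set, of an arrival order of the online vertices.\<close>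

definition arrival_order :: "('l, 'r) wbigraph \<Rightarrow> ('l set \<Rightarrow> 'l list) \<Rightarrow> bool" where
  "arrival_order G \<sigma> \<longleftrightarrow> (\<forall>H\<subseteq>left G. distinct (\<sigma> H) \<and> set (\<sigma> H) = left G - H)"

text \<open>
  A randomized algorithm takes \<open>p\<close>, the instance, the history set and the arrival sequence to
  the distribution of its output. This type does not itself enforce online access to the
  instance; \<open>greedy_based\<close> has it because the step for \<open>u\<close> only inspects \<open>induced G (S \<union> {u})\<close>,
  where \<open>S\<close> is part of the history set.
\<close>

type_synonym ('l, 'r) aos_algorithm =
  "real \<Rightarrow> ('l, 'r) wbigraph \<Rightarrow> 'l set \<Rightarrow> 'l list \<Rightarrow> ('l \<times> 'r) set pmf"

definition expected_alg ::
  "('l, 'r) aos_algorithm \<Rightarrow> real \<Rightarrow> ('l, 'r) wbigraph \<Rightarrow> ('l set \<Rightarrow> 'l list) \<Rightarrow> real" where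
  "expected_alg A p G \<sigma> =
     measure_pmf.expectation
       (bind_pmf (random_subset (left G) p) (\<lambda>H. A p G H (\<sigma> H)))
       (matching_weight G)"

definition expected_opt :: "real \<Rightarrow> ('l, 'r) wbigraph \<Rightarrow> real" where
  "expected_opt p G =
     measure_pmf.expectation (random_subset (left G) p)
       (\<lambda>H. max_matching_weight (induced G (left G - H)))"

definition competitive :: "real \<Rightarrow> real \<Rightarrow> ('l, 'r) aos_algorithm \<Rightarrow> bool" where
  "competitive c p A \<longleftrightarrow>
     (\<forall>G \<sigma>. wf_wbigraph G \<and> arrival_order G \<sigma> \<longrightarrow>
        expected_alg A p G \<sigma> \<ge> c * expected_opt p G)"

definition subsampled_greedy_based :: "('l, 'r) aos_algorithm" where
  "subsampled_greedy_based p G H us =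
     map_pmf (\<lambda>H'. greedy_based G H' us) (random_subset H ((1 - p) / p))"

end

theory Submission
  imports Defs
begin

text \<open>
  With \<open>q = 1 - p\<close>, every left vertex is independently a sample (in \<open>S = H'\<close>) with probability \<open>q\<close>,
  online (in \<open>T = O\<close>) with probability \<open>q\<close>, or neither, so \<open>S\<close> and \<open>T\<close> are exchangeable. Call an
  edge \<open>(u, r)\<close> with \<open>u \<in> T\<close> a candidate if it lies in the greedy matching of \<open>S \<union> {u}\<close>. Every right
  vertex that has a candidate is matched by the algorithm along one of its candidates, so at worst,
  whatever the arrival order, along its last one in the greedy order.
  Moving \<open>u\<close> from \<open>S\<close> to \<open>T\<close> shows that an edge is a candidate at least as often as it is in the
  greedy matching of \<open>S\<close>. Moving the next candidate of \<open>r\<close> from \<open>T\<close> to \<open>S\<close> injects the event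
  that \<open>(u, r)\<close> is a non-last candidate into the event that it is a last candidate, so a candidate is
  last at least half of the time. Hence the algorithm gets at least half of the expected greedy weight
  of \<open>S\<close>, which is at least half of the expected optimum of \<open>S\<close>, and by exchangeability that is the
  expected optimum of \<open>T\<close>.
\<close>

section \<open>Greedy matchings along an edge list, and candidates\<close>

definition greedy_on :: "('l \<times> 'r) list \<Rightarrow> 'l set \<Rightarrow> ('l \<times> 'r) set" where
  "greedy_on xs U = foldl greedy_step {} (filter (\<lambda>e. fst e \<in> U) xs)"

definition candidate :: "('l \<times> 'r) list \<Rightarrow> 'l set \<Rightarrow> 'l set \<Rightarrow> 'l \<times> 'r \<Rightarrow> bool" where
  "candidate xs S T e \<longleftrightarrow> fst e \<in> T \<and> e \<in> greedy_on xs (insert (fst e) S)"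

definition before :: "'a list \<Rightarrow> 'a \<Rightarrow> 'a \<Rightarrow> bool" where
  "before xs x y \<longleftrightarrow> (\<exists>ys zs. xs = ys @ x # zs \<and> y \<in> set zs)"

definition last_candidates :: "('l \<times> 'r) list \<Rightarrow> 'l set \<Rightarrow> 'l set \<Rightarrow> ('l \<times> 'r) set" where
  "last_candidates xs S T = {e. candidate xs S T e \<and>
     (\<forall>e'. candidate xs S T e' \<and> snd e' = snd e \<longrightarrow> \<not> before xs e e')}"

text \<open>Greedy depends only on the ranking and the set of present left vertices, so later proofs
  can induct over the edge list from its end.\<close>

lemma greedy_induced: "greedy (induced G U) = greedy_on (ranking G) U"
  by (simp add: greedy_def induced_def greedy_on_def)

lemma greedy_on_Nil [simp]: "greedy_on [] U = {}"
  by (simp add: greedy_on_def)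

lemma greedy_on_snoc:
  "greedy_on (xs @ [e]) U =
     (if fst e \<in> U \<and> fst e \<notin> fst ` greedy_on xs U \<and> snd e \<notin> snd ` greedy_on xs U
      then insert e (greedy_on xs U) else greedy_on xs U)"
  by (auto simp: greedy_on_def greedy_step_def)

lemma greedy_on_mono_append: "greedy_on xs U \<subseteq> greedy_on (xs @ ys) U"
  by (induction ys rule: rev_induct) (auto simp: greedy_on_snoc simp flip: append_assoc)

lemma greedy_on_subset: "greedy_on xs U \<subseteq> {e \<in> set xs. fst e \<in> U}"
  by (induction xs rule: rev_induct) (auto simp: greedy_on_snoc)

lemma greedy_on_append_subset: "greedy_on (xs @ ys) U \<subseteq> greedy_on xs U \<union> set ys"
  by (induction ys rule: rev_induct) (auto simp: greedy_on_snoc simp flip: append_assoc)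

lemma inj_on_snd_greedy_on: "inj_on snd (greedy_on xs U)"
  by (induction xs rule: rev_induct) (auto simp: greedy_on_snoc inj_on_def image_iff)

text \<open>The fate of \<open>e\<close> is settled when it is processed: later edges cannot remove
  it, and distinctness rules out another occurrence.\<close>

lemma mem_greedy_on_iff:
  assumes "distinct (ys @ e # zs)"
  shows "e \<in> greedy_on (ys @ e # zs) U \<longleftrightarrow>
    fst e \<in> U \<and> fst e \<notin> fst ` greedy_on ys U \<and> snd e \<notin> snd ` greedy_on ys U"
proof -
  have "e \<in> greedy_on (ys @ e # zs) U \<longleftrightarrow> e \<in> greedy_on (ys @ [e]) U"
    using greedy_on_append_subset[of "ys @ [e]" zs U] greedy_on_mono_append[of "ys @ [e]" U zs] assms
    by auto
  moreover have "e \<notin> greedy_on ys U"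
    using greedy_on_subset[of ys U] assms by auto
  ultimately show ?thesis
    by (auto simp: greedy_on_snoc)
qed

text \<open>Vertices that would each stay unmatched if added to \<open>S\<close> alone do not
  interact: on every prefix the matching is that of \<open>S\<close>, and it already blocks their
  next edge.\<close>

lemma greedy_on_Un:
  assumes "\<And>u. u \<in> U \<Longrightarrow> u \<notin> fst ` greedy_on xs (insert u S)"
  shows "greedy_on xs (S \<union> U) = greedy_on xs S"
  using assms
proof (induction xs arbitrary: U rule: rev_induct)
  case Nil
  show ?case by simp
next
  case (snoc e xs)
  have sub: "u \<notin> fst ` greedy_on xs (insert u S)" if "u \<in> U" for u
    using snoc.prems[OF that] greedy_on_mono_append[of xs "insert u S" "[e]"] by auto
  then have eq: "greedy_on xs (S \<union> U) = greedy_on xs S"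
    by (rule snoc.IH)
  show ?case
  proof (cases "fst e \<in> U - S")
    case True
    \<comment> \<open>The induction hypothesis for a singleton shows that \<open>e\<close> is
      blocked by the matching of \<open>S\<close> itself.\<close>
    have "greedy_on xs (insert (fst e) S) = greedy_on xs S"
      using snoc.IH[of "{fst e}"] sub True by simp
    with snoc.prems[of "fst e"] True have "fst e \<in> fst ` greedy_on xs S \<or> snd e \<in> snd ` greedy_on xs S"
      by (auto simp: greedy_on_snoc split: if_splits)
    with True show ?thesis by (auto simp: greedy_on_snoc eq)
  next
    case False
    then show ?thesis by (auto simp: greedy_on_snoc eq)
  qed
qed

lemma greedy_on_insert:
  assumes "u \<notin> fst ` greedy_on xs (insert u S)"
  shows "greedy_on xs (insert u S) = greedy_on xs S"
  using greedy_on_Un[of "{u}" xs S] assms by simp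

text \<open>While \<open>fst e\<close> is unmatched, its presence does not change the run, so
  freeness of \<open>snd e\<close> can be tested with \<open>S\<close> alone.\<close>

lemma candidate_split:
  assumes "distinct (ys @ e # zs)" "fst e \<notin> S"
  shows "candidate (ys @ e # zs) S T e \<longleftrightarrow> fst e \<in> T \<and>
    fst e \<notin> fst ` greedy_on ys (insert (fst e) S) \<and> snd e \<notin> snd ` greedy_on ys S"
  using greedy_on_insert[of "fst e" ys S]
  by (auto simp: candidate_def mem_greedy_on_iff[OF assms(1)])

text \<open>
  Moving the first candidate of \<open>snd e\<close> after \<open>e\<close> into the sample leaves the greedy matching
  unchanged up to that candidate and then covers \<open>snd e\<close>, which makes \<open>e\<close> a last candidate.
\<close>

lemma next_candidate_swap:
  assumes xs: "distinct xs" and disj: "S \<inter> T = {}"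
    and e: "candidate xs S T e" and f: "candidate xs S T f" "snd f = snd e" "before xs e f"
  obtains u where "u \<in> T" "e \<in> last_candidates xs (insert u S) (T - {u})"
    "(u, snd e) \<in> greedy_on xs (insert u S)"
proof -
  obtain ys zs where xs_eq: "xs = ys @ e # zs" and "f \<in> set zs"
    using f(3) unfolding before_def by blast
  with f obtain ms g ws where zs: "zs = ms @ g # ws" and g: "candidate xs S T g" "snd g = snd e"
    and least: "\<And>h. h \<in> set ms \<Longrightarrow> \<not> (candidate xs S T h \<and> snd h = snd e)"
    using split_list_first_prop[of zs "\<lambda>h. candidate xs S T h \<and> snd h = snd e"] by blast
  define u where "u = fst g"
  define S' where "S' = insert u S"
  have uT: "u \<in> T" and g_in: "g \<in> greedy_on xs S'"
    using g disj by (auto simp: u_def S'_def candidate_def)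
  have eT: "fst e \<in> T"
    using e by (simp add: candidate_def)
  have g_split: "xs = (ys @ e # ms) @ g # ws"
    by (simp add: xs_eq zs)
  \<comment> \<open>Greedy on \<open>S'\<close> picks \<open>g\<close>, so both endpoints of
    \<open>g\<close> are free just before it.\<close>
  have free_u: "u \<notin> fst ` greedy_on (ys @ e # ms) S'" and free_r: "snd e \<notin> snd ` greedy_on (ys @ e # ms) S'"
    using g_in xs mem_greedy_on_iff[of "ys @ e # ms" g ws S'] g(2) by (auto simp: g_split u_def)
  have free: "u \<notin> fst ` greedy_on as S'" "snd e \<notin> snd ` greedy_on as S'" "greedy_on as S' = greedy_on as S"
    if "ys @ e # ms = as @ bs" for as bs
  proof -
    have "greedy_on as S' \<subseteq> greedy_on (ys @ e # ms) S'"
      unfolding that by (rule greedy_on_mono_append)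
    then show *: "u \<notin> fst ` greedy_on as S'" "snd e \<notin> snd ` greedy_on as S'"
      using free_u free_r by auto
    from *(1) show "greedy_on as S' = greedy_on as S"
      unfolding S'_def by (rule greedy_on_insert)
  qed
  have "fst e \<noteq> u"
    using g(2) xs by (auto simp: u_def xs_eq zs prod_eq_iff)
  have move: "candidate xs S T h \<longleftrightarrow> candidate xs S' (T - {u}) h"
    if h: "fst h \<noteq> u" "fst h \<in> T" "snd h = snd e" and split: "ys @ e # ms = as @ h # bs" for h as bs
  proof -
    define v where "v = fst h"
    have xs': "xs = as @ h # (bs @ g # ws)"
      using split by (simp add: xs_eq zs)
    have vS: "v \<notin> S" "v \<notin> S'" using h disj by (auto simp: v_def S'_def)
    note as = free[OF split]
    \<comment> \<open>By \<open>candidate_split\<close> and \<open>as(3)\<close>, the two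
      candidacies can differ only in whether \<open>v\<close> is free on the prefix. Adding
      \<open>u\<close>, which stays unmatched there, does not affect this.\<close>
    have "v \<notin> fst ` greedy_on as (insert v S) \<longleftrightarrow> v \<notin> fst ` greedy_on as (insert v S')"
    proof
      assume v: "v \<notin> fst ` greedy_on as (insert v S)"
      have "greedy_on as (S \<union> {u, v}) = greedy_on as S"
        by (rule greedy_on_Un) (use v as(1) in \<open>auto simp: S'_def\<close>)
      moreover have "greedy_on as (insert v S) = greedy_on as S"
        using v by (rule greedy_on_insert)
      ultimately show "v \<notin> fst ` greedy_on as (insert v S')"
        using v by (simp add: S'_def insert_commute)
    next
      assume v: "v \<notin> fst ` greedy_on as (insert v S')"
      then have "greedy_on as (insert v S') = greedy_on as S'"
        by (rule greedy_on_insert)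
      then have "greedy_on as (insert u (insert v S)) = greedy_on as (insert v S)"
        using as(1) by (intro greedy_on_insert) (simp add: S'_def insert_commute)
      then show "v \<notin> fst ` greedy_on as (insert v S)"
        using v by (simp add: S'_def insert_commute)
    qed
    then show ?thesis
      using xs h vS as(3) candidate_split[of as h "bs @ g # ws" S T]
        candidate_split[of as h "bs @ g # ws" S' "T - {u}"]
      by (simp add: xs' v_def)
  qed
  have "candidate xs S' (T - {u}) e"
    using move[of e ys ms] e eT \<open>fst e \<noteq> u\<close> by simp
  \<comment> \<open>A later candidate \<open>h\<close> of \<open>snd e\<close> is excluded by its
    position: before \<open>g\<close> it contradicts the choice of \<open>g\<close>,
    \<open>g\<close> itself has lost \<open>u\<close> from the online set, and after
    \<open>g\<close> the right vertex is already covered by \<open>g\<close>.\<close>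
  moreover have False
    if h: "candidate xs S' (T - {u}) h" "snd h = snd e" "before xs e h" for h
  proof -
    have hT: "fst h \<noteq> u" "fst h \<in> T" using h(1) by (auto simp: candidate_def)
    obtain ys' zs' where "xs = ys' @ e # zs'" "h \<in> set zs'"
      using h(3) unfolding before_def by blast
    moreover from this have "zs' = zs"
      using xs xs_eq by (auto simp: append_eq_append_conv2 append_eq_Cons_conv Cons_eq_append_conv)
    ultimately have "h \<in> set zs" by simp
    then consider "h \<in> set ms" | "h = g" | "h \<in> set ws"
      by (auto simp: zs)
    then show False
    proof cases
      case 1
      then obtain as bs where "ms = as @ h # bs" by (meson split_list)
      then have "candidate xs S T h"
        using move[OF hT h(2), of "ys @ e # as" bs] h(1) by simp
      with least[OF 1] h(2) show False by simp
    next
      case 2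
      with hT show False by (simp add: u_def)
    next
      case 3
      then obtain as bs where ws: "ws = as @ h # bs" by (meson split_list)
      define ps where "ps = ys @ e # ms @ g # as"
      have xs': "xs = ps @ h # bs" by (simp add: ps_def xs_eq zs ws)
      have "distinct ((ys @ e # ms) @ g # as)"
        using xs by (auto simp: xs_eq zs ws)
      then have "g \<in> greedy_on ps S'"
        using g_in xs mem_greedy_on_iff[of "ys @ e # ms" g ws S'] mem_greedy_on_iff[of "ys @ e # ms" g as S']
        by (simp add: g_split ps_def)
      then have "snd h \<in> snd ` greedy_on ps S'"
        using g(2) h(2) by (metis image_eqI)
      moreover have "fst h \<notin> S'"
        using hT disj by (auto simp: S'_def)
      ultimately show False
        using candidate_split[of ps h bs S' "T - {u}"] h(1) xs by (simp add: xs')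
    qed
  qed
  ultimately have "e \<in> last_candidates xs S' (T - {u})"
    unfolding last_candidates_def by blast
  \<comment> \<open>This makes the move reversible: \<open>u\<close> is the greedy partner of
    \<open>snd e\<close> in the new sample.\<close>
  moreover have "(u, snd e) \<in> greedy_on xs S'"
    using g_in g(2) by (simp add: u_def prod_eq_iff flip: g(2))
  ultimately show thesis
    using uT that by (simp add: S'_def)
qed

section \<open>Exchange arguments for the joint law of sample and online set\<close>

definition splits :: "'l set \<Rightarrow> ('l set \<times> 'l set) set" where
  "splits A = {(S, T). S \<subseteq> A \<and> T \<subseteq> A \<and> S \<inter> T = {}}"

text \<open>The probability of the pair \<open>(H', O)\<close> for \<open>q = 1 - p\<close>; it depends only on the union.\<close>

definition split_weight :: "real \<Rightarrow> 'l set \<Rightarrow> 'l set \<times> 'l set \<Rightarrow> real" where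
  "split_weight q A x = q ^ card (fst x \<union> snd x) * (1 - 2 * q) ^ card (A - (fst x \<union> snd x))"

lemma finite_splits: "finite A \<Longrightarrow> finite (splits A)"
  by (rule finite_subset[of _ "Pow A \<times> Pow A"]) (auto simp: splits_def)

lemma split_weight_nonneg: "0 \<le> q \<Longrightarrow> q \<le> 1 / 2 \<Longrightarrow> 0 \<le> split_weight q A x"
  by (simp add: split_weight_def)

text \<open>The injection moves \<open>fst e\<close> from the sample to the online set, and
  \<open>i\<close> moves it back. The union, and with it the weight, is unchanged.\<close>

lemma prob_greedy_le_prob_candidate:
  assumes "finite A" "0 \<le> q" "q \<le> 1 / 2"
  shows "sum (split_weight q A) {x \<in> splits A. e \<in> greedy_on xs (fst x)}
    \<le> sum (split_weight q A) {x \<in> splits A. candidate xs (fst x) (snd x) e}"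
proof (rule sum_le_included[where i = "\<lambda>x. (insert (fst e) (fst x), snd x - {fst e})"])
  show "\<forall>x\<in>{x \<in> splits A. e \<in> greedy_on xs (fst x)}.
    \<exists>y\<in>{x \<in> splits A. candidate xs (fst x) (snd x) e}.
      (insert (fst e) (fst y), snd y - {fst e}) = x \<and> split_weight q A x \<le> split_weight q A y"
  proof
    fix x assume x: "x \<in> {x \<in> splits A. e \<in> greedy_on xs (fst x)}"
    obtain S T where [simp]: "x = (S, T)" by (cases x)
    have u: "fst e \<in> S" using x greedy_on_subset[of xs S] by auto
    have ST: "S \<subseteq> A" "T \<subseteq> A" "S \<inter> T = {}" using x by (auto simp: splits_def)
    let ?y = "(S - {fst e}, insert (fst e) T)"
    have "?y \<in> {x \<in> splits A. candidate xs (fst x) (snd x) e}"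
      using x u ST by (auto simp: splits_def candidate_def insert_absorb)
    moreover have "(insert (fst e) (fst ?y), snd ?y - {fst e}) = x"
      using u ST by auto
    moreover have "split_weight q A x = split_weight q A ?y"
    proof -
      have "fst ?y \<union> snd ?y = fst x \<union> snd x" using u by auto
      then show ?thesis unfolding split_weight_def by simp
    qed
    ultimately show "\<exists>y\<in>{x \<in> splits A. candidate xs (fst x) (snd x) e}.
      (insert (fst e) (fst y), snd y - {fst e}) = x \<and> split_weight q A x \<le> split_weight q A y"
      by (intro bexI[of _ ?y] conjI) (assumption | simp only:)+
  qed
qed (use assms in \<open>auto simp: finite_splits split_weight_nonneg\<close>)

text \<open>By \<open>next_candidate_swap\<close>, the pairs where \<open>e\<close> is a candidate
  but not a last one weigh at most as much as those where it is last. Adding the latter to both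
  sides gives the factor 2.\<close>

lemma prob_candidate_le_prob_last:
  assumes "finite A" "0 \<le> q" "q \<le> 1 / 2" "distinct xs"
  shows "sum (split_weight q A) {x \<in> splits A. candidate xs (fst x) (snd x) e}
    \<le> 2 * sum (split_weight q A) {x \<in> splits A. e \<in> last_candidates xs (fst x) (snd x)}"
proof -
  let ?C = "{x \<in> splits A. candidate xs (fst x) (snd x) e}"
  let ?B = "{x \<in> splits A. e \<in> last_candidates xs (fst x) (snd x)}"
  \<comment> \<open>The vertex that the swap moved, to be sent back online. It exists for every
    image of the swap and is unique because \<open>snd\<close> is injective on a greedy
    matching.\<close>
  let ?partner = "\<lambda>S. THE u. (u, snd e) \<in> greedy_on xs S"
  have "sum (split_weight q A) (?C - ?B) \<le> sum (split_weight q A) ?B"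
  proof (rule sum_le_included[where
        i = "\<lambda>x. (fst x - {?partner (fst x)}, insert (?partner (fst x)) (snd x))"])
    show "\<forall>x\<in>?C - ?B. \<exists>y\<in>?B. (fst y - {?partner (fst y)}, insert (?partner (fst y)) (snd y)) = x \<and>
        split_weight q A x \<le> split_weight q A y"
    proof
      fix x assume x: "x \<in> ?C - ?B"
      obtain S T where [simp]: "x = (S, T)" by (cases x)
      have ST: "S \<subseteq> A" "T \<subseteq> A" "S \<inter> T = {}" using x by (auto simp: splits_def)
      from x have e: "candidate xs S T e" "e \<notin> last_candidates xs S T" by simp_all
      then obtain f where "candidate xs S T f" "snd f = snd e" "before xs e f"
        unfolding last_candidates_def by blast
      then obtain u where u: "u \<in> T" "e \<in> last_candidates xs (insert u S) (T - {u})"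
        "(u, snd e) \<in> greedy_on xs (insert u S)"
        by (rule next_candidate_swap[OF assms(4) ST(3) e(1)])
      let ?y = "(insert u S, T - {u})"
      have p: "?partner (insert u S) = u"
      proof (rule the_equality)
        show "v = u" if "(v, snd e) \<in> greedy_on xs (insert u S)" for v
          using inj_onD[OF inj_on_snd_greedy_on _ that u(3)] by simp
      qed (rule u(3))
      have "?y \<in> ?B"
        using u ST by (auto simp: splits_def)
      moreover have "(fst ?y - {?partner (fst ?y)}, insert (?partner (fst ?y)) (snd ?y)) = x"
        using u(1) ST by (auto simp: p)
      moreover have "split_weight q A x = split_weight q A ?y"
      proof -
        have "fst ?y \<union> snd ?y = fst x \<union> snd x" using u(1) by auto
        then show ?thesis unfolding split_weight_def by simp
      qed
      ultimately show "\<exists>y\<in>?B. (fst y - {?partner (fst y)}, insert (?partner (fst y)) (snd y)) = x \<and>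
        split_weight q A x \<le> split_weight q A y"
        by (intro bexI[of _ ?y] conjI) (assumption | simp only:)+
    qed
  qed (use assms in \<open>auto simp: finite_splits split_weight_nonneg\<close>)
  moreover have "?B \<subseteq> ?C"
    by (auto simp: last_candidates_def)
  moreover have "finite ?C"
    using finite_splits[OF assms(1)] by simp
  ultimately show ?thesis
    using sum.subset_diff[of ?B ?C "split_weight q A"] by linarith
qed

section \<open>Charging arguments, and greedy against the optimum\<close>

lemma sum_charge_le:
  fixes w :: "'a \<Rightarrow> real"
  assumes "finite N" "finite M" "\<And>f. f \<in> M \<Longrightarrow> 0 \<le> w f" "inj_on h N"
    and "\<And>e. e \<in> N \<Longrightarrow> \<exists>f\<in>M. h f = h e \<and> w e \<le> w f"
  shows "sum w N \<le> sum w M"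
\<comment> \<open>Injectivity of \<open>h\<close> on \<open>N\<close> lets \<open>f\<close>
  determine the one element charged to it, so no element of \<open>M\<close> pays twice.\<close>
proof (rule sum_le_included[where i = "\<lambda>f. the_inv_into N h (h f)"])
  show "\<forall>e\<in>N. \<exists>f\<in>M. the_inv_into N h (h f) = e \<and> w e \<le> w f"
    using assms(4,5) by (metis the_inv_into_f_f)
qed (use assms in auto)

text \<open>Either \<open>e\<close> is chosen itself, or an edge chosen earlier, hence at least as
  heavy, shares an endpoint with it.\<close>

lemma greedy_on_blocks:
  assumes "sorted_wrt (\<lambda>e f. (w e :: real) \<ge> w f) xs" "e \<in> set xs" "fst e \<in> U"
  shows "\<exists>f\<in>greedy_on xs U. (fst f = fst e \<or> snd f = snd e) \<and> w e \<le> w f"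
  using assms
proof (induction xs rule: rev_induct)
  case (snoc g xs)
  show ?case
  proof (cases "e \<in> set xs")
    case True
    with snoc obtain f where "f \<in> greedy_on xs U" "(fst f = fst e \<or> snd f = snd e) \<and> w e \<le> w f"
      by (auto simp: sorted_wrt_append)
    then show ?thesis
      using greedy_on_mono_append[of xs U "[g]"] by blast
  next
    case False
    with snoc.prems have [simp]: "g = e" by simp
    have "w e \<le> w f" if "f \<in> greedy_on xs U" for f
      using that snoc.prems(1) greedy_on_subset[of xs U] by (auto simp: sorted_wrt_append)
    then show ?thesis
      using snoc.prems(3) by (auto simp: greedy_on_snoc image_iff) (metis fst_conv snd_conv)+
  qed
qed simp

text \<open>Each edge of a matching is charged to the greedy edge from
  \<open>greedy_on_blocks\<close>. A greedy edge pays at most once through its left and at most once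
  through its right endpoint, hence the factor 2.\<close>

lemma max_matching_weight_le_greedy:
  assumes "wf_wbigraph G"
  shows "max_matching_weight (induced G U) \<le> 2 * sum (weight G) (greedy_on (ranking G) U)"
proof -
  let ?w = "weight G" and ?M = "greedy_on (ranking G) U"
  have wf: "finite (edges G)" "set (ranking G) = edges G" "\<And>e. e \<in> edges G \<Longrightarrow> 0 \<le> ?w e"
    "sorted_wrt (\<lambda>e f. ?w e \<ge> ?w f) (ranking G)"
    using assms finite_subset[of "edges G" "left G \<times> right G"] by (auto simp: wf_wbigraph_def)
  have M: "?M \<subseteq> edges G"
    using greedy_on_subset[of "ranking G" U] wf(2) by auto
  have finM: "finite ?M" using M wf(1) by (rule finite_subset)
  have posM: "0 \<le> ?w f" if "f \<in> ?M" for f using M wf(3) that by blast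
  have "sum ?w N \<le> 2 * sum ?w ?M" if "matching (induced G U) N" for N
  proof -
    have N: "N \<subseteq> {e \<in> edges G. fst e \<in> U}" "inj_on fst N" "inj_on snd N"
      using that by (auto simp: matching_def induced_def)
    have finN: "finite N" using N(1) wf(1) by (auto intro: finite_subset)
    define N1 where "N1 = {e \<in> N. \<exists>f\<in>?M. fst f = fst e \<and> ?w e \<le> ?w f}"
    define N2 where "N2 = {e \<in> N. \<exists>f\<in>?M. snd f = snd e \<and> ?w e \<le> ?w f}"
    have sub: "N1 \<subseteq> N" "N2 \<subseteq> N" by (auto simp: N1_def N2_def)
    then have fin: "finite N1" "finite N2" using finN by (auto dest: finite_subset)
    have pos: "0 \<le> ?w e" if "e \<in> N" for e using N(1) wf(3) that by blast
    have "N \<subseteq> N1 \<union> N2"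
    proof
      fix e assume "e \<in> N"
      with N(1) wf(2) have "e \<in> set (ranking G)" "fst e \<in> U" by auto
      from greedy_on_blocks[OF wf(4) this] \<open>e \<in> N\<close> show "e \<in> N1 \<union> N2"
        unfolding N1_def N2_def by blast
    qed
    with sub have "N = N1 \<union> N2" by blast
    \<comment> \<open>An edge may lie in both \<open>N1\<close> and \<open>N2\<close>; counting it
      twice does no harm, as weights are nonnegative.\<close>
    moreover have "0 \<le> sum ?w (N1 \<inter> N2)"
      using pos sub(1) by (intro sum_nonneg) auto
    ultimately have "sum ?w N \<le> sum ?w N1 + sum ?w N2"
      using sum.union_inter[OF fin, of ?w] by simp
    also have "sum ?w N1 \<le> sum ?w ?M"
    proof (rule sum_charge_le[OF fin(1) finM posM])
      show "inj_on fst N1" using N(2) sub(1) by (rule inj_on_subset)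
    qed (auto simp: N1_def)
    also have "sum ?w N2 \<le> sum ?w ?M"
    proof (rule sum_charge_le[OF fin(2) finM posM])
      show "inj_on snd N2" using N(3) sub(2) by (rule inj_on_subset)
    qed (auto simp: N2_def)
    finally show ?thesis by simp
  qed
  moreover have "finite {N. matching (induced G U) N}"
    by (rule finite_subset[of _ "Pow (edges G)"]) (auto simp: matching_def induced_def wf(1))
  moreover have "matching (induced G U) {}"
    by (simp add: matching_def)
  ultimately show ?thesis
    unfolding max_matching_weight_def
    by (subst Max_le_iff) (auto simp: matching_weight_def induced_def)
qed

section \<open>The output of the online algorithm in terms of candidates\<close>

lemma foldl_online_step_subset:
  "set us \<subseteq> T \<Longrightarrow> (\<And>e. e \<in> M \<Longrightarrow> candidate (ranking G) S T e) \<Longrightarrow>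
   e \<in> foldl (online_step G S) M us \<Longrightarrow> candidate (ranking G) S T e"
proof (induction us arbitrary: M)
  case (Cons u us)
  show ?case
    by (rule Cons.IH[of "online_step G S M u"])
      (use Cons.prems in \<open>auto simp: online_step_def candidate_def greedy_induced\<close>)
qed simp

lemma foldl_online_step_mono: "M \<subseteq> foldl (online_step G S) M us"
proof (induction us arbitrary: M)
  case (Cons u us)
  show ?case using Cons.IH[of "online_step G S M u"] by (auto simp: online_step_def)
qed simp

text \<open>When \<open>u\<close> arrives, \<open>r\<close> is already taken or becomes taken by
  \<open>(u, r)\<close>, and matched edges are never dropped.\<close>

lemma foldl_online_step_covers:
  "u \<in> set us \<Longrightarrow> (u, r) \<in> greedy_on (ranking G) (insert u S) \<Longrightarrow>
   r \<in> snd ` foldl (online_step G S) M us"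
proof (induction us arbitrary: M)
  case (Cons v us)
  show ?case
  proof (cases "u = v")
    case True
    have "r \<in> snd ` online_step G S M v"
    proof (cases "r \<in> snd ` M")
      case False
      with Cons.prems True have "(v, r) \<in> online_step G S M v"
        by (simp add: online_step_def greedy_induced)
      then show ?thesis by force
    qed (auto simp: online_step_def)
    then show ?thesis
      using foldl_online_step_mono[of "online_step G S M v" G S us] by auto
  qed (use Cons in auto)
qed simp

lemma before_cases:
  assumes "x \<in> set xs" "y \<in> set xs" "x \<noteq> y"
  shows "before xs x y \<or> before xs y x"
proof -
  obtain ys zs where xs: "xs = ys @ x # zs"
    using assms(1) by (meson split_list)
  then consider "y \<in> set zs" | "y \<in> set ys"
    using assms by auto
  then show ?thesis
  proof cases
    case 2
    then obtain as bs where "ys = as @ y # bs" by (meson split_list)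
    with xs have "xs = as @ y # (bs @ x # zs)" "x \<in> set (bs @ x # zs)" by simp_all
    then show ?thesis unfolding before_def by blast
  qed (use xs in \<open>auto simp: before_def\<close>)
qed

lemma candidate_mem: "candidate xs S T e \<Longrightarrow> e \<in> set xs"
  using greedy_on_subset by (fastforce simp: candidate_def)

lemma last_candidates_subset: "last_candidates xs S T \<subseteq> set xs"
  by (auto simp: last_candidates_def dest: candidate_mem)

text \<open>Of two distinct candidates at one right vertex, the ranking puts one first, and that one
  is not last.\<close>

lemma inj_on_snd_last_candidates: "inj_on snd (last_candidates xs S T)"
proof (rule inj_onI)
  fix e f assume ef: "e \<in> last_candidates xs S T" "f \<in> last_candidates xs S T" "snd e = snd f"
  then have "candidate xs S T e" "candidate xs S T f" "\<not> before xs e f" "\<not> before xs f e"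
    unfolding last_candidates_def by (blast dest: sym)+
  then show "e = f"
    using before_cases candidate_mem by metis
qed

text \<open>Charging along \<open>snd\<close>: the edge matched at a right vertex is itself a
  candidate, so it does not come after the last one and weighs at least as much. The bound is the
  same for every order of \<open>us\<close>.\<close>

lemma greedy_based_weight_ge:
  assumes "wf_wbigraph G" "set us = T"
  shows "sum (weight G) (last_candidates (ranking G) S T) \<le> matching_weight G (greedy_based G S us)"
proof -
  let ?xs = "ranking G" and ?M = "greedy_based G S us"
  have wf: "set ?xs = edges G" "\<And>e. e \<in> edges G \<Longrightarrow> 0 \<le> weight G e"
    "sorted_wrt (\<lambda>e f. weight G e \<ge> weight G f) ?xs"
    using assms by (auto simp: wf_wbigraph_def)
  have M: "candidate ?xs S T f" if "f \<in> ?M" for f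
    using that foldl_online_step_subset[of us T "{}" G S f] assms(2) by (auto simp: greedy_based_def)
  then have sub: "?M \<subseteq> set ?xs" using candidate_mem by blast
  show ?thesis
    unfolding matching_weight_def
  proof (rule sum_charge_le[OF _ _ _ inj_on_snd_last_candidates])
    show "finite (last_candidates ?xs S T)"
      using last_candidates_subset by (rule finite_subset) simp
    show "finite ?M"
      using sub by (rule finite_subset) simp
    show "0 \<le> weight G f" if "f \<in> ?M" for f
      using that sub wf(1,2) by blast
  next
    fix e assume e: "e \<in> last_candidates ?xs S T"
    then have c: "candidate ?xs S T e" by (simp add: last_candidates_def)
    then obtain f where f: "f \<in> ?M" "snd f = snd e"
      using foldl_online_step_covers[of "fst e" us "snd e" G S "{}"] assms(2)
      by (auto simp: candidate_def greedy_based_def)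
    have "\<not> before ?xs e f"
      using e M[OF f(1)] f(2) unfolding last_candidates_def by blast
    then have "f = e \<or> before ?xs f e"
      using before_cases[of e ?xs f] candidate_mem[OF c] candidate_mem[OF M[OF f(1)]] by blast
    then have "weight G e \<le> weight G f"
      using wf(3) by (auto simp: before_def sorted_wrt_append)
    with f show "\<exists>f\<in>?M. snd f = snd e \<and> weight G e \<le> weight G f" by blast
  qed
qed

section \<open>Linearity: from probabilities of single edges to expected weights\<close>

lemma sum_weighted_sets:
  fixes W :: "'a \<Rightarrow> real"
  assumes "finite X" "finite E" "\<And>x. F x \<subseteq> E"
  shows "(\<Sum>x\<in>X. W x * sum w (F x)) = (\<Sum>e\<in>E. w e * sum W {x \<in> X. e \<in> F x})"
proof -
  have "(\<Sum>x\<in>X. W x * sum w (F x)) = (\<Sum>x\<in>X. \<Sum>e\<in>E. if e \<in> F x then W x * w e else 0)"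
  proof (rule sum.cong)
    fix x
    have "{e \<in> E. e \<in> F x} = F x" using assms(3) by blast
    then show "W x * sum w (F x) = (\<Sum>e\<in>E. if e \<in> F x then W x * w e else 0)"
      using sum.inter_filter[OF assms(2), of "\<lambda>e. W x * w e" "\<lambda>e. e \<in> F x"]
      by (simp add: sum_distrib_left)
  qed simp
  also have "\<dots> = (\<Sum>e\<in>E. \<Sum>x\<in>X. if e \<in> F x then W x * w e else 0)"
    by (rule sum.swap)
  also have "\<dots> = (\<Sum>e\<in>E. w e * sum W {x \<in> X. e \<in> F x})"
    by (simp add: sum.inter_filter[OF assms(1), symmetric] sum_distrib_left mult.commute)
  finally show ?thesis .
qed

text \<open>The two exchange bounds are chained edge by edge and then summed, which needs
  nonnegative edge weights.\<close>

lemma sum_greedy_le_sum_last_candidates: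
  assumes "wf_wbigraph G" "0 \<le> q" "q \<le> 1 / 2"
  shows "(\<Sum>x\<in>splits (left G). split_weight q (left G) x * sum (weight G) (greedy_on (ranking G) (fst x)))
    \<le> 2 * (\<Sum>x\<in>splits (left G). split_weight q (left G) x *
             sum (weight G) (last_candidates (ranking G) (fst x) (snd x)))"
proof -
  let ?A = "left G" and ?xs = "ranking G" and ?w = "weight G"
  have wf: "finite ?A" "set ?xs = edges G" "distinct ?xs" "\<And>e. e \<in> edges G \<Longrightarrow> 0 \<le> ?w e"
    using assms by (auto simp: wf_wbigraph_def)
  have sub: "greedy_on ?xs U \<subseteq> set ?xs" for U
    using greedy_on_subset[of ?xs U] by auto
  have "(\<Sum>e\<in>set ?xs. ?w e * sum (split_weight q ?A) {x \<in> splits ?A. e \<in> greedy_on ?xs (fst x)})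
    \<le> (\<Sum>e\<in>set ?xs. ?w e * (2 * sum (split_weight q ?A)
          {x \<in> splits ?A. e \<in> last_candidates ?xs (fst x) (snd x)}))"
    by (intro sum_mono mult_left_mono order_trans[OF prob_greedy_le_prob_candidate
          prob_candidate_le_prob_last] wf assms) (use wf in auto)
  then have "(\<Sum>e\<in>set ?xs. ?w e * sum (split_weight q ?A) {x \<in> splits ?A. e \<in> greedy_on ?xs (fst x)})
    \<le> 2 * (\<Sum>e\<in>set ?xs. ?w e * sum (split_weight q ?A)
          {x \<in> splits ?A. e \<in> last_candidates ?xs (fst x) (snd x)})"
    by (simp only: mult.left_commute[of _ 2] flip: sum_distrib_left)
  then show ?thesis
    by (simp only: sum_weighted_sets[OF finite_splits[OF wf(1)] finite_set sub]
        sum_weighted_sets[OF finite_splits[OF wf(1)] finite_set last_candidates_subset])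
qed

section \<open>Expectations over random subsets as finite sums\<close>

lemma expectation_random_subset:
  fixes f :: "'a set \<Rightarrow> real"
  assumes A: "finite A" and q: "0 \<le> q" "q \<le> 1"
  shows "measure_pmf.expectation (random_subset A q) f
    = (\<Sum>B\<in>Pow A. q ^ card B * (1 - q) ^ card (A - B) * f B)"
proof -
  \<comment> \<open>\<open>?c\<close> turns a set into its characteristic function. As the default
    is \<open>False\<close>, functions in the support vanish outside \<open>A\<close>, so subsets of
    \<open>A\<close> account for all of them.\<close>
  let ?P = "Pi_pmf A False (\<lambda>_. bernoulli_pmf q)" and ?c = "\<lambda>B x. x \<in> B"
  have "measure_pmf.expectation (random_subset A q) f
      = (\<Sum>g\<in>?c ` Pow A. f {x \<in> A. g x} * pmf ?P g)"
    unfolding random_subset_def integral_map_pmf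
  proof (rule integral_measure_pmf_real)
    fix g assume "g \<in> set_pmf ?P"
    then have "g = ?c {x \<in> A. g x}"
      using set_Pi_pmf_subset[OF A, of False "\<lambda>_. bernoulli_pmf q"] by (auto simp: fun_eq_iff)
    then show "g \<in> ?c ` Pow A" by blast
  qed (use A in simp)
  also have "\<dots> = (\<Sum>B\<in>Pow A. f {x \<in> A. ?c B x} * pmf ?P (?c B))"
    by (subst sum.reindex) (auto simp: inj_on_def fun_eq_iff)
  also have "\<dots> = (\<Sum>B\<in>Pow A. q ^ card B * (1 - q) ^ card (A - B) * f B)"
  proof (rule sum.cong)
    fix B assume "B \<in> Pow A"
    then have B: "B \<subseteq> A" by simp
    have "pmf ?P (?c B) = (\<Prod>x\<in>A. pmf (bernoulli_pmf q) (x \<in> B))"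
      by (rule pmf_Pi') (use A B in auto)
    also have "\<dots> = (\<Prod>x\<in>A - B. pmf (bernoulli_pmf q) (x \<in> B)) * (\<Prod>x\<in>B. pmf (bernoulli_pmf q) (x \<in> B))"
      using A B by (intro prod.subset_diff)
    also have "\<dots> = (1 - q) ^ card (A - B) * q ^ card B"
      using q by simp
    finally show "f {x \<in> A. ?c B x} * pmf ?P (?c B) = q ^ card B * (1 - q) ^ card (A - B) * f B"
      using B by (simp add: Int_absorb1 flip: Int_def Collect_conj_eq)
  qed simp
  finally show ?thesis .
qed

lemma pmf_random_subset:
  assumes "finite A" "0 \<le> q" "q \<le> 1" "B \<subseteq> A"
  shows "pmf (random_subset A q) B = q ^ card B * (1 - q) ^ card (A - B)"
proof -
  have "pmf (random_subset A q) B = measure_pmf.expectation (random_subset A q) (indicator {B})"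
    by (simp add: pmf.rep_eq)
  also have "\<dots> = (\<Sum>C\<in>Pow A. if C = B then q ^ card C * (1 - q) ^ card (A - C) else 0)"
    by (subst expectation_random_subset) (use assms in \<open>auto simp: indicator_def intro!: sum.cong\<close>)
  also have "\<dots> = q ^ card B * (1 - q) ^ card (A - B)"
    using assms by simp
  finally show ?thesis .
qed

lemma set_pmf_random_subset: "set_pmf (random_subset A q) \<subseteq> Pow A"
  by (auto simp: random_subset_def)

text \<open>The change of variables is \<open>T = A - H\<close>, with \<open>H\<close> recovered as
  \<open>A - T\<close>.\<close>

lemma sum_splits:
  assumes "finite A"
  shows "(\<Sum>H\<in>Pow A. \<Sum>S\<in>Pow H. f S (A - H)) = (\<Sum>x\<in>splits A. f (fst x) (snd x))"
proof -
  have "(\<Sum>H\<in>Pow A. \<Sum>S\<in>Pow H. f S (A - H)) = (\<Sum>(H, S)\<in>(SIGMA H:Pow A. Pow H). f S (A - H))"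
    using assms by (subst sum.Sigma) (auto intro: finite_subset)
  also have "\<dots> = (\<Sum>x\<in>splits A. f (fst x) (snd x))"
    by (rule sum.reindex_bij_witness[where i = "\<lambda>(S, T). (A - T, S)" and j = "\<lambda>(H, S). (S, A - H)"])
      (auto simp: splits_def)
  finally show ?thesis .
qed

text \<open>With the symmetry of \<open>split_weight\<close>, this is the exchangeability of sample
  and online set.\<close>

lemma sum_splits_swap: "(\<Sum>x\<in>splits A. f (fst x) (snd x)) = (\<Sum>x\<in>splits A. f (snd x) (fst x))"
  by (rule sum.reindex_bij_witness[where i = prod.swap and j = prod.swap]) (auto simp: splits_def)

text \<open>The rate \<open>(1 - p) / p\<close> balances the two sets: a vertex is sampled with
  probability \<open>p * ((1 - p) / p) = 1 - p\<close>, online with \<open>1 - p\<close>, and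
  neither with \<open>p * (1 - (1 - p) / p) = 2 * p - 1\<close>.\<close>

lemma subsample_weight:
  assumes p: "1 / 2 < p" "p \<le> 1" and A: "finite A" "S \<subseteq> H" "H \<subseteq> A"
  shows "p ^ card H * (1 - p) ^ card (A - H) * (((1 - p) / p) ^ card S * (1 - (1 - p) / p) ^ card (H - S))
    = split_weight (1 - p) A (S, A - H)"
proof -
  have fin: "finite S" "finite H" using A by (auto intro: finite_subset)
  have H: "card H = card S + card (H - S)"
    using A fin card_Diff_subset[of S H] card_mono[of H S] by simp
  have "card (S \<union> (A - H)) = card S + card (A - H)"
    using A fin by (intro card_Un_disjoint) auto
  moreover have "A - (S \<union> (A - H)) = H - S" using A by auto
  moreover have "1 - (1 - p) / p = (2 * p - 1) / p" "1 - 2 * (1 - p) = 2 * p - 1"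
    using p by (auto simp: field_simps)
  ultimately show ?thesis
    using p by (simp add: split_weight_def H power_add power_divide)
qed

text \<open>The sum stays indexed by \<open>H\<close>, on which the arrival order \<sigma> may
  depend.\<close>

lemma expected_alg_eq:
  assumes p: "1 / 2 < p" "p \<le> 1" and G: "wf_wbigraph G"
  shows "expected_alg subsampled_greedy_based p G \<sigma> =
    (\<Sum>H\<in>Pow (left G). \<Sum>S\<in>Pow H. split_weight (1 - p) (left G) (S, left G - H) *
        matching_weight G (greedy_based G S (\<sigma> H)))"
proof -
  let ?A = "left G"
  have A: "finite ?A" using G by (simp add: wf_wbigraph_def)
  have q: "0 \<le> (1 - p) / p" "(1 - p) / p \<le> 1" using p by (auto simp: field_simps)
  have fin: "finite (set_pmf (random_subset H q))" if "H \<subseteq> ?A" for H q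
    by (rule finite_subset[OF set_pmf_random_subset]) (simp add: finite_subset[OF that A])
  have "expected_alg subsampled_greedy_based p G \<sigma> = (\<Sum>H\<in>Pow ?A. pmf (random_subset ?A p) H *
      measure_pmf.expectation (random_subset H ((1 - p) / p))
        (\<lambda>S. matching_weight G (greedy_based G S (\<sigma> H))))"
    unfolding expected_alg_def subsampled_greedy_based_def
  proof (subst pmf_expectation_bind[OF _ _ set_pmf_random_subset])
    show "finite (set_pmf (map_pmf (\<lambda>S. greedy_based G S (\<sigma> H)) (random_subset H ((1 - p) / p))))"
      if "H \<in> Pow ?A" for H
      using fin[of H] that by simp
  qed (use A in \<open>simp_all only: finite_Pow_iff integral_map_pmf real_scaleR_def\<close>)
  also have "\<dots> = (\<Sum>H\<in>Pow ?A. \<Sum>S\<in>Pow H. split_weight (1 - p) ?A (S, ?A - H) *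
        matching_weight G (greedy_based G S (\<sigma> H)))"
  proof (rule sum.cong)
    fix H assume "H \<in> Pow ?A"
    then have H: "H \<subseteq> ?A" "finite H" using A by (auto intro: finite_subset)
    show "pmf (random_subset ?A p) H * measure_pmf.expectation (random_subset H ((1 - p) / p))
        (\<lambda>S. matching_weight G (greedy_based G S (\<sigma> H))) =
      (\<Sum>S\<in>Pow H. split_weight (1 - p) ?A (S, ?A - H) * matching_weight G (greedy_based G S (\<sigma> H)))"
      unfolding expectation_random_subset[OF H(2) q] sum_distrib_left
    proof (rule sum.cong)
      fix S assume "S \<in> Pow H"
      then have S: "S \<subseteq> H" by simp
      have "pmf (random_subset ?A p) H = p ^ card H * (1 - p) ^ card (?A - H)"
        using p A H(1) by (intro pmf_random_subset) simp_all
      then have "pmf (random_subset ?A p) H * (((1 - p) / p) ^ card S * (1 - (1 - p) / p) ^ card (H - S))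
          = split_weight (1 - p) ?A (S, ?A - H)"
        by (simp only: subsample_weight[OF p A S H(1)])
      then show "pmf (random_subset ?A p) H * (((1 - p) / p) ^ card S * (1 - (1 - p) / p) ^ card (H - S) *
          matching_weight G (greedy_based G S (\<sigma> H))) =
        split_weight (1 - p) ?A (S, ?A - H) * matching_weight G (greedy_based G S (\<sigma> H))"
        by (simp only: mult.assoc[symmetric])
    qed simp
  qed simp
  finally show ?thesis .
qed

text \<open>The optimum ignores the sample, whose conditional probabilities sum to 1, so summing
  over samples as well is harmless. Exchangeability then replaces the online set by the sample, on
  which greedy can be compared with the optimum.\<close>

lemma expected_opt_eq:
  assumes p: "1 / 2 < p" "p \<le> 1" and G: "wf_wbigraph G"
  shows "expected_opt p G = (\<Sum>x\<in>splits (left G). split_weight (1 - p) (left G) x *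
    max_matching_weight (induced G (fst x)))"
proof -
  let ?A = "left G" and ?f = "\<lambda>U. max_matching_weight (induced G U)" and ?q = "(1 - p) / p"
  have A: "finite ?A" using G by (simp add: wf_wbigraph_def)
  have q: "0 \<le> ?q" "?q \<le> 1" using p by (auto simp: field_simps)
  have "expected_opt p G = (\<Sum>H\<in>Pow ?A. p ^ card H * (1 - p) ^ card (?A - H) * ?f (?A - H))"
    unfolding expected_opt_def using A p by (simp add: expectation_random_subset)
  also have "\<dots> = (\<Sum>H\<in>Pow ?A. \<Sum>S\<in>Pow H. split_weight (1 - p) ?A (S, ?A - H) * ?f (?A - H))"
  proof (rule sum.cong)
    fix H assume "H \<in> Pow ?A"
    then have H: "H \<subseteq> ?A" "finite H" using A by (auto intro: finite_subset)
    have one: "(\<Sum>S\<in>Pow H. ?q ^ card S * (1 - ?q) ^ card (H - S)) = 1"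
      using expectation_random_subset[OF H(2) q, of "\<lambda>_. 1"] by simp
    have "(\<Sum>S\<in>Pow H. split_weight (1 - p) ?A (S, ?A - H) * ?f (?A - H)) =
      (\<Sum>S\<in>Pow H. p ^ card H * (1 - p) ^ card (?A - H) * ?f (?A - H) *
        (?q ^ card S * (1 - ?q) ^ card (H - S)))"
      using p A H by (intro sum.cong) (auto simp: mult_ac simp flip: subsample_weight)
    also have "\<dots> = p ^ card H * (1 - p) ^ card (?A - H) * ?f (?A - H)"
      by (simp only: one mult_1_right flip: sum_distrib_left)
    finally show "p ^ card H * (1 - p) ^ card (?A - H) * ?f (?A - H) =
      (\<Sum>S\<in>Pow H. split_weight (1 - p) ?A (S, ?A - H) * ?f (?A - H))" ..
  qed simp
  also have "\<dots> = (\<Sum>x\<in>splits ?A. split_weight (1 - p) ?A (fst x, snd x) * ?f (snd x))"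
    by (rule sum_splits[OF A])
  also have "\<dots> = (\<Sum>x\<in>splits ?A. split_weight (1 - p) ?A (snd x, fst x) * ?f (fst x))"
    by (rule sum_splits_swap)
  also have "\<dots> = (\<Sum>x\<in>splits ?A. split_weight (1 - p) ?A x * ?f (fst x))"
    by (simp add: split_weight_def Un_commute)
  finally show ?thesis .
qed

theorem theorem3p3:
  fixes p :: real
  assumes "1 / 2 < p" and "p \<le> 1"
  shows "competitive (1 / 4) p (subsampled_greedy_based :: ('l, 'r) aos_algorithm)"
  unfolding competitive_def
proof (intro allI impI, elim conjE)
  fix G :: "('l, 'r) wbigraph" and \<sigma>
  assume G: "wf_wbigraph G" and \<sigma>: "arrival_order G \<sigma>"
  let ?A = "left G" and ?W = "split_weight (1 - p) (left G)" and ?w = "weight G" and ?xs = "ranking G"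
  have A: "finite ?A" using G by (simp add: wf_wbigraph_def)
  have q: "0 \<le> 1 - p" "1 - p \<le> 1 / 2" using assms by auto
  have "expected_opt p G \<le> (\<Sum>x\<in>splits ?A. ?W x * (2 * sum ?w (greedy_on ?xs (fst x))))"
    unfolding expected_opt_eq[OF assms G]
    by (intro sum_mono mult_left_mono max_matching_weight_le_greedy split_weight_nonneg G q)
  also have "\<dots> = 2 * (\<Sum>x\<in>splits ?A. ?W x * sum ?w (greedy_on ?xs (fst x)))"
    by (simp add: sum_distrib_left mult.left_commute)
  \<comment> \<open>One factor 2 is lost by greedy against the optimum, the other by keeping only
    last candidates.\<close>
  also have "\<dots> \<le> 4 * (\<Sum>x\<in>splits ?A. ?W x * sum ?w (last_candidates ?xs (fst x) (snd x)))"
    using sum_greedy_le_sum_last_candidates[OF G q] by simp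
  \<comment> \<open>Back to summation over history sets, so that the algorithm can be compared
    termwise for the order chosen after seeing \<open>H\<close>.\<close>
  also have "(\<Sum>x\<in>splits ?A. ?W x * sum ?w (last_candidates ?xs (fst x) (snd x))) =
    (\<Sum>H\<in>Pow ?A. \<Sum>S\<in>Pow H. ?W (S, ?A - H) * sum ?w (last_candidates ?xs S (?A - H)))"
    using sum_splits[OF A, of "\<lambda>S T. ?W (S, T) * sum ?w (last_candidates ?xs S T)"] by simp
  also have "\<dots> \<le> expected_alg subsampled_greedy_based p G \<sigma>"
    unfolding expected_alg_eq[OF assms G]
    using \<sigma> by (intro sum_mono mult_left_mono greedy_based_weight_ge split_weight_nonneg G q)
      (auto simp: arrival_order_def)
  finally show "1 / 4 * expected_opt p G \<le> expected_alg subsampled_greedy_based p G \<sigma>"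
    by simp
qed

end
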